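(* Let $t\ge 1$. There exists a deterministic broadcast algorithm against $t$ adversarial edges which, for every $n$-node, $(2t+1)$ edge-connected graph $G$ of diameter $D$ and source node $s$ holding a message $m_0$, solves the adversarial broadcast task in the adversarial \textsc{CONGEST} model with round complexity $(tD\log n)^{O(t)}$. Moreover, this algorithm can be implemented in $O(tD\log n)$ rounds of the \textsc{LOCAL} model (i.e., the same model without the bound on message size).
   Context: Adversarial CONGEST model: the network is an $n$-node graph $G=(V,E)$ with a processor at each node; nodes have unique $O(\log n)$-bit identifiers; initially each node knows only the identifiers of its incident edges and a polynomial estimate of $n$ (nodes do not know the topology or the diameter). Communication proceeds in synchronous rounds in which each node may send an $O(\log n)$-bit message on each incident edge. A computationally unbounded adversary controls a fixed set $F\subseteq E$ of at most $t$ edges, unknown to the nodes (nodes know the bound $t$). The adversary knows the topology, the protocol and the nodes' random coins, and is adaptive: in each round it may send arbitrary messages over each edge of $F$ (possibly different in each direction), chosen based on all messages exchanged in the whole network so far. Adversarial broadcast task: given a $(2t+1)$ edge-connected graph and a source $s$ holding $m_0$, all nodes must output $m_0$ (ignoring all other messages). *)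

theory Defs
  imports Complex_Main "HOL-Library.Extended_Nat"
begin

section \<open>Graphs\<close>

text \<open>Finite simple graphs; a vertex is identified with its (unique, numerical) identifier, so
  that the edge \<open>{u, v}\<close> is itself the identifier of an edge.\<close>

definition simple_graph :: "nat set \<Rightarrow> nat set set \<Rightarrow> bool" where
  "simple_graph V E \<longleftrightarrow> finite V \<and> V \<noteq> {} \<and> (\<forall>e\<in>E. e \<subseteq> V \<and> card e = 2)"

definition adj :: "nat set set \<Rightarrow> (nat \<times> nat) set" where
  "adj E = {(u, v). {u, v} \<in> E}"

definition connected_graph :: "nat set \<Rightarrow> nat set set \<Rightarrow> bool" where
  "connected_graph V E \<longleftrightarrow> (\<forall>u\<in>V. \<forall>v\<in>V. (u, v) \<in> (adj E)\<^sup>*)"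

definition edge_connected :: "nat \<Rightarrow> nat set \<Rightarrow> nat set set \<Rightarrow> bool" where
  "edge_connected k V E \<longleftrightarrow>
     2 \<le> card V \<and> (\<forall>X\<subseteq>E. card X < k \<longrightarrow> connected_graph V (E - X))"

text \<open>Meaningful for vertices in the same connected component only.\<close>

definition gdist :: "nat set set \<Rightarrow> nat \<Rightarrow> nat \<Rightarrow> nat" where
  "gdist E u v = (LEAST k. (u, v) \<in> adj E ^^ k)"

definition diameter :: "nat set \<Rightarrow> nat set set \<Rightarrow> nat" where
  "diameter V E = Max {gdist E u v |u v. u \<in> V \<and> v \<in> V}"


section \<open>Networks and the initial knowledge of the nodes\<close>

type_synonym message = "bool list"

record network =
  nodes :: "nat set"
  links :: "nat set set"
  source :: nat
  payload :: message
  estimate :: nat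

text \<open>The exponent \<open>\<kappa>\<close> makes the \<open>O(log n)\<close> and polynomial bounds of the model explicit:
  identifiers are below \<open>n ^ \<kappa>\<close> (at most \<open>\<kappa> log n\<close> bits), the source message has at most
  \<open>\<kappa> log n\<close> bits, and the common estimate of \<open>n\<close> lies between \<open>n\<close> and \<open>n ^ \<kappa>\<close>.\<close>

definition network_ok :: "nat \<Rightarrow> network \<Rightarrow> bool" where
  "network_ok \<kappa> N \<longleftrightarrow>
     simple_graph (nodes N) (links N) \<and>
     source N \<in> nodes N \<and>
     (\<forall>v\<in>nodes N. v < card (nodes N) ^ \<kappa>) \<and>
     real (length (payload N)) \<le> real \<kappa> * log 2 (real (card (nodes N))) \<and>
     card (nodes N) \<le> estimate N \<and> estimate N \<le> card (nodes N) ^ \<kappa>"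

record knowledge =
  own_id :: nat
  incident :: "nat set set"
  size_estimate :: nat
  input :: "message option"

definition initial_knowledge :: "network \<Rightarrow> nat \<Rightarrow> knowledge" where
  "initial_knowledge N u =
     \<lparr> own_id = u,
       incident = {e \<in> links N. u \<in> e},
       size_estimate = estimate N,
       input = (if u = source N then Some (payload N) else None) \<rparr>"


section \<open>Deterministic protocols and their executions\<close>

text \<open>A history lists, round by round, the messages a node has received, indexed by the other
  endpoint of the edge they arrived on. The empty message also stands for silence. Since nodes
  are computationally unbounded, the state of a node is its initial knowledge together with
  its history; \<open>send P k h v\<close> is what a node in this state sends over its edge to \<open>v\<close> in
  the next round.\<close>

type_synonym history = "(nat \<Rightarrow> message) list"

record protocol =
  send :: "knowledge \<Rightarrow> history \<Rightarrow> nat \<Rightarrow> message"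
  decide :: "knowledge \<Rightarrow> history \<Rightarrow> message option"

text \<open>A transcript lists, round by round, the messages delivered in the whole network;
  the message delivered from \<open>u\<close> to \<open>v\<close> has index \<open>(u, v)\<close>. An adversary maps the transcript
  of the past rounds to the messages it places on its edges, separately for each direction.
  The adversary is quantified after the network and the protocol, hence may depend on them;
  as protocols are deterministic, everything the nodes are about to send is then a function of
  the transcript, too.\<close>

type_synonym transcript = "(nat \<times> nat \<Rightarrow> message) list"

type_synonym adversary = "transcript \<Rightarrow> nat \<times> nat \<Rightarrow> message"

definition history_of :: "transcript \<Rightarrow> nat \<Rightarrow> history" where
  "history_of T u = map (\<lambda>msgs v. msgs (v, u)) T"

definition next_round ::
    "protocol \<Rightarrow> network \<Rightarrow> nat set set \<Rightarrow> adversary \<Rightarrow> transcript \<Rightarrow> nat \<times> nat \<Rightarrow> message" where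
  "next_round P N F A T = (\<lambda>(u, v).
     if {u, v} \<in> F then A T (u, v)
     else if {u, v} \<in> links N then send P (initial_knowledge N u) (history_of T u) v
     else [])"

primrec run :: "protocol \<Rightarrow> network \<Rightarrow> nat set set \<Rightarrow> adversary \<Rightarrow> nat \<Rightarrow> transcript" where
  "run P N F A 0 = []"
| "run P N F A (Suc r) = run P N F A r @ [next_round P N F A (run P N F A r)]"

definition decision_at ::
    "protocol \<Rightarrow> network \<Rightarrow> nat set set \<Rightarrow> adversary \<Rightarrow> nat \<Rightarrow> nat \<Rightarrow> message option" where
  "decision_at P N F A u r =
     decide P (initial_knowledge N u) (history_of (run P N F A r) u)"

text \<open>Outputs are irrevocable: the output of a node is the first decision it takes.\<close>

definition outputs_by ::
    "protocol \<Rightarrow> network \<Rightarrow> nat set set \<Rightarrow> adversary \<Rightarrow> nat \<Rightarrow> nat \<Rightarrow> message \<Rightarrow> bool" where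
  "outputs_by P N F A u r m \<longleftrightarrow>
     (\<exists>i\<le>r. decision_at P N F A u i = Some m \<and> (\<forall>j<i. decision_at P N F A u j = None))"


section \<open>CONGEST and LOCAL\<close>

text \<open>The two models differ in the capacity of an edge, the number of bits it carries per round
  and direction: it is infinite for LOCAL.\<close>

definition congest_capacity :: "nat \<Rightarrow> network \<Rightarrow> enat" where
  "congest_capacity \<beta> N = enat (nat \<lfloor>real \<beta> * log 2 (real (card (nodes N)))\<rfloor>)"

definition adversary_within :: "enat \<Rightarrow> adversary \<Rightarrow> bool" where
  "adversary_within b A \<longleftrightarrow> (\<forall>T e. enat (length (A T e)) \<le> b)"

definition congest_protocol :: "nat \<Rightarrow> nat \<Rightarrow> protocol \<Rightarrow> bool" where
  "congest_protocol \<kappa> \<beta> P \<longleftrightarrow>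
     (\<forall>N F A r u v. network_ok \<kappa> N \<longrightarrow> F \<subseteq> links N \<longrightarrow>
        adversary_within (congest_capacity \<beta> N) A \<longrightarrow> {u, v} \<in> links N \<longrightarrow>
        enat (length (send P (initial_knowledge N u) (history_of (run P N F A r) u) v))
          \<le> congest_capacity \<beta> N)"

definition solves_broadcast :: "enat \<Rightarrow> nat \<Rightarrow> protocol \<Rightarrow> network \<Rightarrow> nat \<Rightarrow> bool" where
  "solves_broadcast b t P N R \<longleftrightarrow>
     (\<forall>F A. F \<subseteq> links N \<longrightarrow> card F \<le> t \<longrightarrow> adversary_within b A \<longrightarrow>
        (\<forall>u\<in>nodes N. outputs_by P N F A u R (payload N)))"

text \<open>\<open>Q\<close> is an implementation of the CONGEST protocol \<open>P\<close> in the LOCAL model: whatever the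
  adversary does to \<open>Q\<close>, every node outputs what it outputs in some execution of \<open>P\<close> on the same
  network and with the same adversarial edges. This is not restricted to graphs and fault sets on
  which broadcast can be guaranteed, where it would just say that both protocols are correct.\<close>

definition local_implementation :: "nat \<Rightarrow> nat \<Rightarrow> protocol \<Rightarrow> protocol \<Rightarrow> bool" where
  "local_implementation \<kappa> \<beta> Q P \<longleftrightarrow>
     (\<forall>N F A. network_ok \<kappa> N \<longrightarrow> F \<subseteq> links N \<longrightarrow> adversary_within \<infinity> A \<longrightarrow>
        (\<exists>A'. adversary_within (congest_capacity \<beta> N) A' \<and>
           (\<forall>u\<in>nodes N. \<forall>m.
              (\<exists>r. outputs_by Q N F A u r m) \<longleftrightarrow> (\<exists>r. outputs_by P N F A' u r m))))"

end

theory Submission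
  imports Defs
begin

text \<open>The message is flooded simultaneously inside many subgraphs. A flood is reliable if its
  subgraph contains no adversarial edge, so a node accepts \<open>m\<close> once, for every set of at most \<open>t\<close>
  edges, some flood that avoids this set delivers \<open>m\<close>: applied to the adversarial set, this shows
  that \<open>m\<close> is genuine. Conversely, deleting at most \<open>2t\<close> edges (the adversarial ones and the ones of
  a given set) from a \<open>(2t+1)\<close> edge-connected graph of diameter \<open>D\<close> leaves a path of length
  \<open>L = O(tD)\<close> from the source, and it suffices that some subgraph contains this path and avoids the
  deleted edges. Such subgraphs are cut out by the residues of the edge codes modulo \<open>q\<close>, where
  \<open>q = O(tL log n)\<close> is enough because the least common multiple of \<open>1, \<dots>, 2m+1\<close> is at least \<open>4^m\<close>.
  There are \<open>(tL log n) ^ O(t)\<close> of them. Sending one bit of each flood per LOCAL round takes messages of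
  that many bits; transmitting these bit by bit turns the LOCAL protocol into a CONGEST protocol,
  with the two executions determining each other.\<close>

section \<open>Residues separating two sets of numbers\<close>

text \<open>The quotient is the Beta integral of \<open>x ^ a * (1 - x) ^ b\<close> over [0, 1].
  Induction on \<open>b\<close> expands one factor \<open>1 - x\<close>; for \<open>b = 0\<close>
  the value is \<open>1 / (a + 1)\<close>, whose denominator divides \<open>d\<close>.\<close>

lemma fact_quotient_integral:
  assumes "\<forall>q\<in>{1..M}. q dvd d" and "a + b + 1 \<le> M"
  shows "real d * (fact a * fact b / fact (a + b + 1)) \<in> \<int>"
  using assms(2)
proof (induction b arbitrary: a)
  case 0
  have "(a + 1) dvd d"
    using assms(1) 0 by auto
  then obtain k where k: "d = (a + 1) * k"
    by (elim dvdE)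
  have "real d * (fact a * fact 0 / fact (a + 0 + 1)) = real k"
  proof -
    have "real d * (fact a * fact 0 / fact (a + 0 + 1)) =
        real k * ((real a + 1) * fact a) / ((real a + 1) * fact a)"
    proof -
      have "fact (a + 0 + 1) = (real a + 1) * fact a" "real d = real k * (real a + 1)"
        unfolding k by (simp_all add: algebra_simps)
      then show ?thesis
        by (simp only: fact_0 mult_1_right times_divide_eq_right mult.assoc)
    qed
    also have "\<dots> = real k"
      by (rule nonzero_mult_div_cancel_right) (simp add: add_eq_0_iff)
    finally show ?thesis .
  qed
  then show ?case
    by simp
next
  case (Suc b)
  have *: "(fact a * fact (Suc b) / fact (a + Suc b + 1) :: real) =
      fact a * fact b / fact (a + b + 1) - fact (Suc a) * fact b / fact (Suc a + b + 1)"
  proof -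
    define F :: real where "F = fact (a + b + 1)"
    have "F \<noteq> 0" "real a + real b + 2 \<noteq> 0"
      unfolding F_def by (simp_all add: fact_nonzero del: fact_Suc)
    moreover have "fact (a + Suc b + 1) = (real a + real b + 2) * F"
        "fact (Suc a + b + 1) = (real a + real b + 2) * F"
      unfolding F_def by (simp_all add: algebra_simps)
    ultimately show ?thesis
      unfolding F_def[symmetric] by (simp add: divide_simps) (simp add: algebra_simps)
  qed
  show ?case
    unfolding * right_diff_distrib by (intro Ints_diff Suc.IH) (use Suc.prems in auto)
qed

text \<open>Integral-free form of \<open>x * (1 - x) \<le> 1 / 4\<close> on [0, 1]: each step
  multiplies the left side by \<open>4 * (m + 1) ^ 2\<close> and the right side by the larger
  \<open>(2 * m + 3) * (2 * m + 2)\<close>.\<close>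

lemma four_pow_fact_le: "4 ^ m * (fact m * fact m) \<le> (fact (m + m + 1) :: real)"
proof (induction m)
  case (Suc m)
  have "4 ^ Suc m * (fact (Suc m) * fact (Suc m)) =
      (4 * (real m + 1)\<^sup>2) * (4 ^ m * (fact m * fact m))"
    by (simp add: power2_eq_square algebra_simps)
  also have "\<dots> \<le> ((2 * real m + 3) * (2 * real m + 2)) * fact (m + m + 1)"
    by (rule mult_mono[OF _ Suc.IH]) (auto simp: power2_eq_square algebra_simps)
  also have "\<dots> = fact (Suc m + Suc m + 1)"
    by (simp add: algebra_simps)
  finally show ?case .
qed simp

text \<open>Nair's argument: \<open>d\<close> times the Beta integral \<open>m! m! / (2m+1)!\<close> is a positive integer.\<close>

lemma common_multiple_ge_four_pow:
  assumes "\<forall>q\<in>{1..2 * m + 1}. q dvd d" and "d > 0"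
  shows "4 ^ m \<le> d"
proof -
  let ?I = "fact m * fact m / fact (m + m + 1) :: real"
  have "real d * ?I \<in> \<int>"
    by (rule fact_quotient_integral[OF assms(1)]) simp
  then obtain z where z: "real d * ?I = of_int z"
    by (elim Ints_cases)
  moreover have "real d * ?I > 0"
    using assms(2) by simp
  ultimately have "z > 0"
    by (metis of_int_0_less_iff)
  then have "1 \<le> real d * ?I"
    unfolding z by simp
  then have "fact (m + m + 1) \<le> real d * (fact m * fact m)"
    by (simp add: pos_le_divide_eq del: fact_Suc)
  with four_pow_fact_le[of m] have "4 ^ m * (fact m * fact m) \<le> real d * (fact m * fact m)"
    by (rule order.trans)
  then have "real (4 ^ m) \<le> real d"
    by (simp del: fact_Suc)
  then show ?thesis
    unfolding of_nat_le_iff .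
qed

text \<open>The product of all differences is positive and below \<open>4 ^ m\<close>, so some
  \<open>q \<le> 2 * m + 1\<close> does not divide it; such a \<open>q\<close> divides no single
  difference.\<close>

lemma separating_modulus:
  fixes A B :: "nat set"
  assumes "finite A" "finite B" "A \<inter> B = {}" "A \<subseteq> {..<N}" "B \<subseteq> {..<N}"
    and "N ^ (card A * card B) < 4 ^ m"
  shows "\<exists>q>0. q \<le> 2 * m + 1 \<and> (\<forall>x\<in>A. \<forall>y\<in>B. x mod q \<noteq> y mod q)"
proof -
  define d where "d = (\<Prod>x\<in>A. \<Prod>y\<in>B. nat \<bar>int x - int y\<bar>)"
  have "d > 0"
    unfolding d_def using assms(3) by (intro prod_pos) auto
  have "d \<le> (\<Prod>x\<in>A. \<Prod>y\<in>B. N)"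
    unfolding d_def using assms(4,5) by (intro prod_mono conjI) force+
  also have "\<dots> = N ^ (card A * card B)"
    by (simp add: mult.commute flip: power_mult)
  finally have "d < 4 ^ m"
    using assms(6) by simp
  then obtain q where q: "q \<in> {1..2 * m + 1}" "\<not> q dvd d"
    using common_multiple_ge_four_pow[OF _ \<open>d > 0\<close>, of m] by fastforce
  have "x mod q \<noteq> y mod q" if "x \<in> A" "y \<in> B" for x y
  proof
    assume "x mod q = y mod q"
    then have "int q dvd int x - int y"
      by (metis mod_eq_dvd_iff zmod_int)
    then have "q dvd nat \<bar>int x - int y\<bar>"
      by (metis int_dvd_int_iff dvd_abs_iff abs_ge_zero int_nat_eq)
    also have "\<dots> dvd (\<Prod>y\<in>B. nat \<bar>int x - int y\<bar>)"
      using assms(2) that(2) by (intro dvd_prodI)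
    also have "\<dots> dvd d"
      unfolding d_def using assms(1) that(1) by (rule dvd_prodI)
    finally show False
      using q(2) by contradiction
  qed
  then show ?thesis
    using q(1) by (intro exI[of _ q]) auto
qed

section \<open>Distances after edge deletions\<close>

text \<open>The walk is followed until it first meets an edge of \<open>X\<close>: the vertex
  reached is an endpoint of that edge, and the part before it survives the deletion.\<close>

lemma relpow_leaves_or_stays:
  assumes "(u, s) \<in> adj E ^^ k"
  shows "\<exists>y\<in>insert s (\<Union>X). \<exists>j\<le>k. (u, y) \<in> adj (E - X) ^^ j"
  using assms
proof (induction k arbitrary: u)
  case 0
  then show ?case
    by auto
next
  case (Suc k)
  obtain w where w: "(u, w) \<in> adj E" "(w, s) \<in> adj E ^^ k"
    using Suc.prems by (rule relpow_Suc_E2)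
  show ?case
  proof (cases "{u, w} \<in> X")
    case True
    then show ?thesis
      by (intro bexI[of _ u] exI[of _ 0]) auto
  next
    case False
    then have "(u, w) \<in> adj (E - X)"
      using w(1) by (simp add: adj_def)
    moreover obtain y j where "y \<in> insert s (\<Union>X)" "j \<le> k" "(w, y) \<in> adj (E - X) ^^ j"
      using Suc.IH[OF w(2)] by blast
    ultimately show ?thesis
      by (intro bexI[of _ y] exI[of _ "Suc j"] conjI relpow_Suc_I2) auto
  qed
qed

lemma adj_relpow_sym: "(u, v) \<in> adj E ^^ k \<Longrightarrow> (v, u) \<in> adj E ^^ k"
proof (induction k arbitrary: v)
  case (Suc k)
  then obtain w where "(u, w) \<in> adj E ^^ k" "(w, v) \<in> adj E"
    by (elim relpow_Suc_E)
  moreover from this have "(v, w) \<in> adj E"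
    by (simp add: adj_def insert_commute)
  ultimately show ?case
    using Suc.IH by (blast intro: relpow_Suc_I2)
qed simp

lemma gdist_least: "(u, v) \<in> adj E ^^ k \<Longrightarrow> gdist E u v \<le> k"
  unfolding gdist_def by (rule Least_le)

lemma gdist_relpow: "(u, v) \<in> (adj E)\<^sup>* \<Longrightarrow> (u, v) \<in> adj E ^^ gdist E u v"
  unfolding gdist_def by (rule LeastI_ex) (simp add: rtrancl_is_UN_relpow)

lemma gdist_triangle:
  assumes "(s, u) \<in> (adj E)\<^sup>*" "(u, v) \<in> adj E ^^ k"
  shows "gdist E s v \<le> gdist E s u + k"
  using assms by (metis gdist_least gdist_relpow relpow_add relcompI)

text \<open>The vertex after \<open>i\<close> steps of a shortest path lies at level
  \<open>i\<close>, by the triangle inequality.\<close>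

lemma gdist_level_exists:
  assumes "(s, v) \<in> (adj E)\<^sup>*" "i \<le> gdist E s v"
  obtains w where "(s, w) \<in> (adj E)\<^sup>*" "gdist E s w = i"
proof -
  have "(s, v) \<in> adj E ^^ (i + (gdist E s v - i))"
    using gdist_relpow[OF assms(1)] assms(2) by simp
  then obtain w where w: "(s, w) \<in> adj E ^^ i" "(w, v) \<in> adj E ^^ (gdist E s v - i)"
    unfolding relpow_add by blast
  from w(1) have r: "(s, w) \<in> (adj E)\<^sup>*"
    by (rule relpow_imp_rtrancl)
  moreover have "gdist E s w = i"
    using gdist_least[OF w(1)] gdist_triangle[OF r w(2)] assms(2) by linarith
  ultimately show thesis
    by (rule that)
qed

text \<open>Each level \<open>i \<le> gdist (E - X) s v\<close> has a vertex within distance \<open>D\<close> of \<open>s\<close> or of an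
  endpoint of \<open>X\<close>, and each of these few vertices is that close to at most \<open>2D + 1\<close> levels.\<close>

lemma gdist_delete_edges:
  assumes "finite X" "\<forall>e\<in>X. card e = 2"
    and conn: "(s, v) \<in> (adj (E - X))\<^sup>*"
    and near: "\<And>u. (s, u) \<in> (adj (E - X))\<^sup>* \<Longrightarrow> \<exists>k\<le>D. (u, s) \<in> adj E ^^ k"
  shows "gdist (E - X) s v < (2 * card X + 1) * (2 * D + 1)"
proof -
  let ?d = "gdist (E - X) s" and ?Y = "insert s (\<Union>X)"
  have fin: "finite ?Y"
    using assms(1,2) by (auto intro!: finite_Union simp: card_ge_0_finite)
  have "card (\<Union>X) \<le> (\<Sum>e\<in>X. card e)"
    by (metis assms(1) card_Union_le_sum_card)
  then have card: "card ?Y \<le> 2 * card X + 1"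
    using assms(2) fin card_insert_le_m1 by (simp add: card_insert_if)
  have "{..?d v} \<subseteq> (\<Union>y\<in>?Y. {?d y - D..?d y + D})"
  proof
    fix i
    assume "i \<in> {..?d v}"
    then obtain w where w: "(s, w) \<in> (adj (E - X))\<^sup>*" "?d w = i"
      using gdist_level_exists[OF conn, of i] by auto
    obtain k where "k \<le> D" "(w, s) \<in> adj E ^^ k"
      using near[OF w(1)] by auto
    then obtain y j where y: "y \<in> ?Y" "j \<le> D" "(w, y) \<in> adj (E - X) ^^ j"
      using relpow_leaves_or_stays[of w s k E X] by (meson le_trans)
    have "(s, y) \<in> (adj (E - X))\<^sup>*"
      using w(1) y(3) by (meson relpow_imp_rtrancl rtrancl_trans)
    then have "?d w \<le> ?d y + j" "?d y \<le> ?d w + j"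
      using gdist_triangle w(1) y(3) adj_relpow_sym by metis+
    then show "i \<in> (\<Union>y\<in>?Y. {?d y - D..?d y + D})"
      using w(2) y(1,2) by force
  qed
  then have "card {..?d v} \<le> card (\<Union>y\<in>?Y. {?d y - D..?d y + D})"
    using fin by (intro card_mono finite_UN_I) auto
  also have "\<dots> \<le> (\<Sum>y\<in>?Y. card {?d y - D..?d y + D})"
    by (rule card_UN_le[OF fin])
  also have "\<dots> \<le> (\<Sum>y\<in>?Y. 2 * D + 1)"
    by (intro sum_mono) auto
  also have "\<dots> = card ?Y * (2 * D + 1)"
    by simp
  also have "\<dots> \<le> (2 * card X + 1) * (2 * D + 1)"
    using card by (rule mult_right_mono) simp
  finally show ?thesis
    by simp
qed

lemma relpow_adj_mono: "(u, v) \<in> adj P ^^ k \<Longrightarrow> P \<subseteq> P' \<Longrightarrow> (u, v) \<in> adj P' ^^ k"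
  by (induction k arbitrary: v) (auto simp: adj_def)

text \<open>A sieve only has to let the walk itself through; having at most \<open>k\<close> edges
  is what keeps the modulus small.\<close>

lemma relpow_edge_set:
  assumes "(u, v) \<in> adj E ^^ k"
  obtains P where "finite P" "card P \<le> k" "P \<subseteq> E" "(u, v) \<in> adj P ^^ k"
proof -
  have "\<exists>P. finite P \<and> card P \<le> k \<and> P \<subseteq> E \<and> (u, v) \<in> adj P ^^ k"
    using assms
  proof (induction k arbitrary: v)
    case 0
    then show ?case
      by (intro exI[of _ "{}"]) auto
  next
    case (Suc k)
    then obtain w where w: "(u, w) \<in> adj E ^^ k" "(w, v) \<in> adj E"
      by (elim relpow_Suc_E)
    obtain P where P: "finite P" "card P \<le> k" "P \<subseteq> E" "(u, w) \<in> adj P ^^ k"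
      using Suc.IH[OF w(1)] by blast
    have "(u, w) \<in> adj (insert {w, v} P) ^^ k"
      using P(4) by (rule relpow_adj_mono) auto
    then have "(u, v) \<in> adj (insert {w, v} P) ^^ Suc k"
      by (rule relpow_Suc_I) (simp add: adj_def)
    then show ?case
      using P w(2) by (intro exI[of _ "insert {w, v} P"])
        (auto simp: adj_def card_insert_if)
  qed
  then show thesis
    using that by blast
qed

section \<open>Serialisation of messages\<close>

text \<open>The protocol \<open>Q\<close> may send \<open>b e r\<close> bits per edge in round \<open>r\<close>, where \<open>e\<close> is the estimate
  of the network size; \<open>serialise b Q\<close> spends \<open>b e r\<close> rounds on them, one bit each.\<close>

definition offset :: "(nat \<Rightarrow> nat) \<Rightarrow> nat \<Rightarrow> nat" where
  "offset b r = (\<Sum>i<r. b i)"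

definition block_of :: "(nat \<Rightarrow> nat) \<Rightarrow> nat \<Rightarrow> nat" where
  "block_of b l = (LEAST r. l < offset b (Suc r))"

text \<open>Only completed blocks are reassembled. \<open>take 1\<close> discards surplus bits of
  the adversary, and a silent round contributes no bit.\<close>

definition deserialise :: "(nat \<Rightarrow> nat) \<Rightarrow> ('a \<Rightarrow> message) list \<Rightarrow> ('a \<Rightarrow> message) list" where
  "deserialise b h =
     map (\<lambda>i x. concat (map (\<lambda>j. take 1 ((h ! j) x)) [offset b i..<offset b (Suc i)]))
       [0..<block_of b (length h)]"

text \<open>A LOCAL adversary may exceed the width of a round, which one bit per CONGEST round
  cannot imitate; executions are therefore compared after truncation.\<close>

definition cut_off :: "(nat \<Rightarrow> nat) \<Rightarrow> ('a \<Rightarrow> message) list \<Rightarrow> ('a \<Rightarrow> message) list" where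
  "cut_off b h = map (\<lambda>i x. take (b i) ((h ! i) x)) [0..<length h]"

text \<open>Inside an unfinished block the decision is withheld, so that decisions of the two
  protocols correspond one to one.\<close>

definition serialise :: "(nat \<Rightarrow> nat \<Rightarrow> nat) \<Rightarrow> protocol \<Rightarrow> protocol" where
  "serialise b Q =
     \<lparr> send = (\<lambda>K h v. let b' = b (size_estimate K) in
         take 1 (drop (length h - offset b' (block_of b' (length h))) (send Q K (deserialise b' h) v))),
       decide = (\<lambda>K h. let b' = b (size_estimate K) in
         if length h = offset b' (block_of b' (length h)) then decide Q K (deserialise b' h)
         else None) \<rparr>"

lemma offset_Suc: "offset b (Suc r) = offset b r + b r"
  by (simp add: offset_def)

lemma strict_mono_offset: "(\<And>i. b i > 0) \<Longrightarrow> strict_mono (offset b)"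
  by (simp add: strict_mono_Suc_iff offset_Suc)

lemma block_of_eq:
  assumes "\<And>i. b i > 0" "offset b r \<le> l" "l < offset b (Suc r)"
  shows "block_of b l = r"
  unfolding block_of_def
proof (rule Least_equality)
  fix r'
  assume "l < offset b (Suc r')"
  then have "offset b r < offset b (Suc r')"
    using assms(2) by simp
  then show "r \<le> r'"
    using strict_mono_less[OF strict_mono_offset[of b]] assms(1) by simp
qed (rule assms(3))

lemma block_of_offset: "(\<And>i. b i > 0) \<Longrightarrow> block_of b (offset b r) = r"
  by (rule block_of_eq) (auto simp: offset_Suc)

lemma block_of_bounds:
  assumes "\<And>i. b i > 0"
  shows "offset b (block_of b l) \<le> l" "l < offset b (Suc (block_of b l))"
proof -
  have "l < offset b (Suc l)"
    using strict_mono_imp_increasing[OF strict_mono_offset[of b], of "Suc l"] assms by simp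
  then show "l < offset b (Suc (block_of b l))"
    unfolding block_of_def by (rule LeastI)
  show "offset b (block_of b l) \<le> l"
  proof (cases "block_of b l")
    case 0
    then show ?thesis
      by (simp add: offset_def)
  next
    case (Suc r)
    then have "r < block_of b l"
      by simp
    then have "\<not> l < offset b (Suc r)"
      unfolding block_of_def by (rule not_less_Least)
    then show ?thesis
      using Suc by simp
  qed
qed

lemma concat_bits: "concat (map (\<lambda>k. take 1 (drop k xs)) [0..<n]) = take n xs"
  by (induction n) (simp_all flip: take_add)

lemma concat_bits_shift: "concat (map (\<lambda>j. take 1 (drop (j - a) xs)) [a..<a + n]) = take n xs"
proof -
  have "[a..<a + n] = map (\<lambda>k. k + a) [0..<n]"
    by (simp add: map_add_upt add.commute)
  then show ?thesis
    using concat_bits[of xs n] by (simp add: o_def)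
qed

section \<open>Bit-by-bit simulation of LOCAL executions\<close>

lemma length_run: "length (run P N F A r) = r"
  by (induction r) auto

lemma length_history_of: "length (history_of T u) = length T"
  by (simp add: history_of_def)

lemma run_nth: "i < r \<Longrightarrow> run P N F A r ! i = next_round P N F A (run P N F A i)"
  by (induction r) (auto simp: nth_append length_run less_Suc_eq)

lemma history_of_deserialise:
  "history_of (deserialise b T) u = deserialise b (history_of T u)"
proof -
  have "j < length T" if "offset b i \<le> j" "j < offset b (Suc i)" "i < block_of b (length T)" for i j
    using not_less_Least[OF that(3)[unfolded block_of_def]] that(2) by simp
  then show ?thesis
    by (auto simp: deserialise_def history_of_def intro!: ext arg_cong[of _ _ concat])
qed

lemma history_of_cut_off: "history_of (cut_off b T) u = cut_off b (history_of T u)"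
  by (auto simp: cut_off_def history_of_def)

lemma size_estimate_initial: "size_estimate (initial_knowledge N u) = estimate N"
  by (simp add: initial_knowledge_def)

lemma congest_capacity_ge_one:
  assumes "network_ok \<kappa> N" "e \<in> links N"
  shows "enat 1 \<le> congest_capacity 1 N"
proof -
  have "e \<subseteq> nodes N" "card e = 2" "finite (nodes N)"
    using assms by (auto simp: network_ok_def simple_graph_def)
  then have "2 \<le> card (nodes N)"
    by (metis card_mono)
  then have "1 \<le> \<lfloor>log 2 (real (card (nodes N)))\<rfloor>"
    by (simp add: le_floor_iff le_log_iff)
  then show ?thesis
    by (simp add: congest_capacity_def le_nat_iff)
qed

text \<open>The cut-off conditions say that bits beyond the width do not influence \<open>Q\<close>,
  so unlimited adversarial messages gain nothing over truncated ones.\<close>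

locale bounded_protocol =
  fixes Q :: protocol and b :: "nat \<Rightarrow> nat \<Rightarrow> nat"
  assumes pos: "b e r > 0"
    and send_bound: "length (send Q K h v) \<le> b (size_estimate K) (length h)"
    and send_cut_off: "send Q K (cut_off (b (size_estimate K)) h) v = send Q K h v"
    and decide_cut_off: "decide Q K (cut_off (b (size_estimate K)) h) = decide Q K h"
begin

abbreviation P :: protocol where
  "P \<equiv> serialise b Q"

lemma deserialise_run_eq:
  assumes "offset (b e) r \<le> l" "l < offset (b e) (Suc r)"
  shows "deserialise (b e) (run P N F A l) =
    map (\<lambda>i x. concat (map (\<lambda>j. take 1 (next_round P N F A (run P N F A j) x))
      [offset (b e) i..<offset (b e) (Suc i)])) [0..<r]"
proof -
  have "block_of (b e) l = r"
    using assms pos by (intro block_of_eq) auto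
  moreover have "j < l" if "i < r" "j < offset (b e) (Suc i)" for i j
  proof -
    have "offset (b e) (Suc i) \<le> offset (b e) r"
      using that(1) strict_mono_offset[of "b e"] pos by (simp add: strict_mono_less_eq)
    then show ?thesis
      using that(2) assms(1) by linarith
  qed
  ultimately show ?thesis
    unfolding deserialise_def
    by (intro map_cong ext arg_cong[of _ _ concat]) (simp_all add: length_run run_nth)
qed

text \<open>The hypothesis relates the two adversaries only on \<open>F\<close> and along the two
  executions. It constructs neither from the other, so the lemma serves to translate adversaries in
  both directions.\<close>

lemma deserialise_run:
  assumes "F \<subseteq> links N"
    and adv: "\<And>r u v. {u, v} \<in> F \<Longrightarrow>
      concat (map (\<lambda>j. take 1 (A (run P N F A j) (u, v)))
        [offset (b (estimate N)) r..<offset (b (estimate N)) (Suc r)]) =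
      take (b (estimate N) r) (A' (run Q N F A' r) (u, v))"
  shows "deserialise (b (estimate N)) (run P N F A (offset (b (estimate N)) r)) =
    cut_off (b (estimate N)) (run Q N F A' r)"
proof (induction r)
  case 0
  show ?case
    using pos by (simp add: deserialise_def cut_off_def block_of_offset length_run)
next
  case (Suc r)
  let ?b = "b (estimate N)"
  have at_offset: "offset ?b r \<le> offset ?b r" "offset ?b r < offset ?b (Suc r)" for r
    using pos by (simp_all add: offset_Suc)
  \<comment> \<open>Within a block the reassembled history is constant, so all bits sent during it
    come from the same message of \<open>Q\<close>.\<close>
  have same: "deserialise ?b (run P N F A j) = deserialise ?b (run P N F A (offset ?b r))"
    if "offset ?b r \<le> j" "j < offset ?b (Suc r)" for j
    using deserialise_run_eq[OF that] deserialise_run_eq[OF at_offset] by simp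
  have "concat (map (\<lambda>j. take 1 (next_round P N F A (run P N F A j) (u, v)))
        [offset ?b r..<offset ?b (Suc r)]) =
      take (?b r) (next_round Q N F A' (run Q N F A' r) (u, v))" for u v
  proof (cases "{u, v} \<in> F \<or> {u, v} \<notin> links N")
    case True
    then show ?thesis
      using adv assms(1) by (auto simp: next_round_def)
  next
    case False
    let ?K = "initial_knowledge N u"
    let ?msg = "send Q ?K (history_of (run Q N F A' r) u) v"
    have "next_round P N F A (run P N F A j) (u, v) = take 1 (drop (j - offset ?b r) ?msg)"
      if "j \<in> set [offset ?b r..<offset ?b (Suc r)]" for j
    proof -
      have "block_of ?b j = r"
        using that pos by (intro block_of_eq) auto
      moreover have "deserialise ?b (history_of (run P N F A j) u) =
          cut_off ?b (history_of (run Q N F A' r) u)"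
        using same[of j] that Suc.IH by (simp flip: history_of_deserialise history_of_cut_off)
      ultimately show ?thesis
        using False send_cut_off[of ?K]
        by (simp add: next_round_def serialise_def length_history_of length_run
            size_estimate_initial)
    qed
    then have "concat (map (\<lambda>j. take 1 (next_round P N F A (run P N F A j) (u, v)))
        [offset ?b r..<offset ?b (Suc r)]) =
      concat (map (\<lambda>j. take 1 (drop (j - offset ?b r) ?msg)) [offset ?b r..<offset ?b (Suc r)])"
      by (intro arg_cong[of _ _ concat] map_cong) auto
    also have "\<dots> = take (?b r) ?msg"
      unfolding offset_Suc by (rule concat_bits_shift)
    finally show ?thesis
      using False by (simp add: next_round_def)
  qed
  note block = this
  have "deserialise ?b (run P N F A (offset ?b (Suc r))) =
      deserialise ?b (run P N F A (offset ?b r)) @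
        [\<lambda>x. concat (map (\<lambda>j. take 1 (next_round P N F A (run P N F A j) x))
          [offset ?b r..<offset ?b (Suc r)])]"
    unfolding deserialise_run_eq[OF at_offset] by simp
  also have "\<dots> = cut_off ?b (run Q N F A' r) @
      [\<lambda>x. take (?b r) (next_round Q N F A' (run Q N F A' r) x)]"
    unfolding Suc.IH using block by (intro arg_cong2[of _ _ _ _ "(@)"]) auto
  also have "\<dots> = cut_off ?b (run Q N F A' (Suc r))"
    by (simp add: cut_off_def nth_append length_run)
  finally show ?case .
qed

lemma decision_at_serialise:
  assumes "F \<subseteq> links N"
    and "\<And>r u v. {u, v} \<in> F \<Longrightarrow>
      concat (map (\<lambda>j. take 1 (A (run P N F A j) (u, v)))
        [offset (b (estimate N)) r..<offset (b (estimate N)) (Suc r)]) =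
      take (b (estimate N) r) (A' (run Q N F A' r) (u, v))"
  shows "decision_at P N F A u l =
    (if l = offset (b (estimate N)) (block_of (b (estimate N)) l)
     then decision_at Q N F A' u (block_of (b (estimate N)) l) else None)"
proof (cases "l = offset (b (estimate N)) (block_of (b (estimate N)) l)")
  case True
  let ?K = "initial_knowledge N u"
  define r where "r = block_of (b (estimate N)) l"
  have "deserialise (b (estimate N)) (history_of (run P N F A l) u) =
      cut_off (b (estimate N)) (history_of (run Q N F A' r) u)"
    using deserialise_run[OF assms, of r] True
    by (simp add: r_def flip: history_of_deserialise history_of_cut_off)
  then show ?thesis
    using True decide_cut_off[of ?K]
    by (simp add: decision_at_def serialise_def length_history_of length_run
        size_estimate_initial r_def)
next
  case False
  then show ?thesis
    by (simp add: decision_at_def serialise_def length_history_of length_run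
        size_estimate_initial)
qed

text \<open>\<open>offset\<close> is strictly increasing and every other round is undecided, so a
  first decision at \<open>i\<close> corresponds to one at the offset of \<open>i\<close>.\<close>

lemma outputs_by_serialise:
  assumes "\<And>l. decision_at P N F A u l =
    (if l = offset (b (estimate N)) (block_of (b (estimate N)) l)
     then decision_at Q N F A' u (block_of (b (estimate N)) l) else None)"
  shows "outputs_by Q N F A' u r m \<Longrightarrow> outputs_by P N F A u (offset (b (estimate N)) r) m"
    and "(\<exists>r. outputs_by Q N F A' u r m) \<longleftrightarrow> (\<exists>r. outputs_by P N F A u r m)"
proof -
  let ?o = "offset (b (estimate N))" and ?blk = "block_of (b (estimate N))"
  have mono: "?o i < ?o j \<longleftrightarrow> i < j" "?o i \<le> ?o j \<longleftrightarrow> i \<le> j" for i j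
    using strict_mono_offset[of "b (estimate N)"] pos
    by (simp_all add: strict_mono_less strict_mono_less_eq)
  have at: "decision_at P N F A u (?o i) = decision_at Q N F A' u i" for i
    using assms[of "?o i"] pos by (simp add: block_of_offset)
  show 1: "outputs_by P N F A u (?o r) m" if Q: "outputs_by Q N F A' u r m" for r
  proof -
    obtain i where i: "i \<le> r" "decision_at Q N F A' u i = Some m"
        "\<And>j. j < i \<Longrightarrow> decision_at Q N F A' u j = None"
      using Q unfolding outputs_by_def by blast
    have "decision_at P N F A u l = None" if "l < ?o i" for l
    proof (cases "l = ?o (?blk l)")
      case True
      then have "?blk l < i"
        using that mono(1)[of "?blk l" i] by simp
      then show ?thesis
        using assms[of l] i(3) by simp
    qed (simp add: assms)
    then show ?thesis
      unfolding outputs_by_def using i(1,2) at[of i] mono(2)[of i r]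
      by (intro exI[of _ "?o i"]) simp
  qed
  have 2: "\<exists>r. outputs_by Q N F A' u r m" if P: "outputs_by P N F A u l m" for l
  proof -
    obtain i where i: "decision_at P N F A u i = Some m"
        "\<And>j. j < i \<Longrightarrow> decision_at P N F A u j = None"
      using P unfolding outputs_by_def by blast
    then have eq: "i = ?o (?blk i)" and "decision_at Q N F A' u (?blk i) = Some m"
      using assms[of i] by (auto split: if_splits)
    moreover have "decision_at Q N F A' u j = None" if "j < ?blk i" for j
    proof -
      have "?o j < i"
        using that mono(1)[of j "?blk i"] eq by simp
      then show ?thesis
        using i(2)[of "?o j"] at[of j] by simp
    qed
    ultimately show ?thesis
      unfolding outputs_by_def by blast
  qed
  show "(\<exists>r. outputs_by Q N F A' u r m) \<longleftrightarrow> (\<exists>r. outputs_by P N F A u r m)"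
    using 1 2 by blast
qed

lemma congest_protocol_serialise: "congest_protocol \<kappa> 1 P"
  unfolding congest_protocol_def
proof (intro allI impI)
  fix N F A r u v
  assume N: "network_ok \<kappa> N" and e: "{u, v} \<in> links N"
  have "enat (length (send P (initial_knowledge N u) (history_of (run P N F A r) u) v)) \<le> enat 1"
    by (simp add: serialise_def Let_def)
  also have "\<dots> \<le> congest_capacity 1 N"
    by (rule congest_capacity_ge_one[OF N e])
  finally show "enat (length (send P (initial_knowledge N u) (history_of (run P N F A r) u) v))
    \<le> congest_capacity 1 N" .
qed

lemma local_implementation_serialise: "local_implementation \<kappa> 1 Q P"
  unfolding local_implementation_def
proof (intro allI impI)
  fix N F A
  assume N: "network_ok \<kappa> N" and F: "F \<subseteq> links N"
  let ?b = "b (estimate N)"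
  \<comment> \<open>The run of \<open>Q\<close> against \<open>A\<close> is fixed, so
    \<open>A'\<close> can replay its messages bit by bit from the round number alone. Off
    \<open>F\<close> it is silent, because without edges the capacity may be 0.\<close>
  define A' :: adversary where
    "A' T x = (let r = block_of ?b (length T) in
       if {fst x, snd x} \<in> F then take 1 (drop (length T - offset ?b r) (A (run Q N F A r) x))
       else [])" for T x
  have "concat (map (\<lambda>j. take 1 (A' (run P N F A' j) (u, v))) [offset ?b r..<offset ?b (Suc r)]) =
      take (?b r) (A (run Q N F A r) (u, v))" if "{u, v} \<in> F" for r u v
  proof -
    have "A' (run P N F A' j) (u, v) = take 1 (drop (j - offset ?b r) (A (run Q N F A r) (u, v)))"
      if "j \<in> set [offset ?b r..<offset ?b (Suc r)]" for j
    proof -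
      have "block_of ?b j = r"
        using that pos by (intro block_of_eq) auto
      then show ?thesis
        using \<open>{u, v} \<in> F\<close> by (simp add: A'_def length_run)
    qed
    then have "concat (map (\<lambda>j. take 1 (A' (run P N F A' j) (u, v)))
          [offset ?b r..<offset ?b (Suc r)]) =
        concat (map (\<lambda>j. take 1 (drop (j - offset ?b r) (A (run Q N F A r) (u, v))))
          [offset ?b r..<offset ?b (Suc r)])"
      by (intro arg_cong[of _ _ concat] map_cong) auto
    then show ?thesis
      unfolding offset_Suc concat_bits_shift .
  qed
  from outputs_by_serialise(2)[OF decision_at_serialise[OF F this]]
  have "\<forall>u\<in>nodes N. \<forall>m. (\<exists>r. outputs_by Q N F A u r m) \<longleftrightarrow> (\<exists>r. outputs_by P N F A' u r m)"
    by blast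
  moreover have "adversary_within (congest_capacity 1 N) A'"
    unfolding adversary_within_def
  proof (intro allI)
    fix T x
    show "enat (length (A' T x)) \<le> congest_capacity 1 N"
    proof (cases "{fst x, snd x} \<in> F")
      case True
      then have "enat 1 \<le> congest_capacity 1 N"
        using F by (intro congest_capacity_ge_one[OF N]) auto
      moreover have "enat (length (A' T x)) \<le> enat 1"
        by (simp add: A'_def Let_def)
      ultimately show ?thesis
        by (rule order.trans[rotated])
    qed (simp add: A'_def Let_def zero_enat_def[symmetric])
  qed
  ultimately show "\<exists>A'. adversary_within (congest_capacity 1 N) A' \<and>
      (\<forall>u\<in>nodes N. \<forall>m. (\<exists>r. outputs_by Q N F A u r m) \<longleftrightarrow> (\<exists>r. outputs_by P N F A' u r m))"
    by blast
qed

text \<open>The LOCAL adversary sends at once the bits that \<open>A\<close> places during a whole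
  block. The capacity \<open>c\<close> is arbitrary because receivers read only the first bit of
  each message.\<close>

lemma solves_broadcast_serialise:
  assumes "solves_broadcast \<infinity> t Q N R"
  shows "solves_broadcast c t P N (offset (b (estimate N)) R)"
  unfolding solves_broadcast_def
proof (intro allI impI ballI)
  fix F A u
  assume F: "F \<subseteq> links N" "card F \<le> t" and u: "u \<in> nodes N"
  let ?b = "b (estimate N)"
  define A' :: adversary where
    "A' T x = concat (map (\<lambda>j. take 1 (A (run P N F A j) x))
       [offset ?b (length T)..<offset ?b (Suc (length T))])" for T x
  have "length (concat (map (\<lambda>j. take 1 (f j)) xs)) \<le> length xs" for f :: "nat \<Rightarrow> message" and xs
    by (induction xs) auto
  from this[of _ "[offset ?b r..<offset ?b (Suc r)]" for r]
  have "concat (map (\<lambda>j. take 1 (A (run P N F A j) (v, w))) [offset ?b r..<offset ?b (Suc r)]) =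
      take (?b r) (A' (run Q N F A' r) (v, w))" for r v w
    by (simp add: A'_def length_run offset_Suc)
  note decision_at_serialise[OF F(1) this]
  then show "outputs_by P N F A u (offset ?b R) (payload N)"
    using assms F u by (intro outputs_by_serialise(1)[where A' = A'])
      (auto simp: solves_broadcast_def adversary_within_def)
qed

end

section \<open>Flooding through sieves\<close>

definition ceil_log :: "nat \<Rightarrow> nat" where
  "ceil_log e = nat \<lceil>log 2 (real e)\<rceil>"

text \<open>The edges a node must reckon with: it does not know the topology, but identifiers are
  below \<open>n ^ \<kappa> \<le> e ^ \<kappa>\<close>.\<close>

definition possible_edges :: "nat \<Rightarrow> nat \<Rightarrow> nat set set" where
  "possible_edges \<kappa> e = {E. E \<subseteq> {..<e ^ \<kappa>} \<and> card E = 2}"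

definition edge_code :: "nat \<Rightarrow> nat \<Rightarrow> nat set \<Rightarrow> nat" where
  "edge_code \<kappa> e E = Min E + e ^ \<kappa> * Max E"

text \<open>A modulus with a list of blocked residues; a flood runs on the edges whose codes avoid
  these residues.\<close>

type_synonym sieve = "nat \<times> nat list"

definition passes :: "nat \<Rightarrow> nat \<Rightarrow> sieve \<Rightarrow> nat set \<Rightarrow> bool" where
  "passes \<kappa> e f E \<longleftrightarrow> edge_code \<kappa> e E mod fst f \<notin> set (snd f)"

text \<open>The bound \<open>2 * m + 1\<close> of \<open>separating_modulus\<close> for
  \<open>r\<close> path edges and \<open>2 * t\<close> blocked ones. The round number
  \<open>r\<close> replaces the path length since the nodes do not know the diameter.\<close>

definition modulus_bound :: "nat \<Rightarrow> nat \<Rightarrow> nat \<Rightarrow> nat \<Rightarrow> nat" where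
  "modulus_bound \<kappa> t e r = 2 * (2 * \<kappa> * t * r * ceil_log e + 1) + 1"

definition sieves :: "nat \<Rightarrow> nat \<Rightarrow> nat \<Rightarrow> nat \<Rightarrow> sieve set" where
  "sieves \<kappa> t e r = (let M = modulus_bound \<kappa> t e r in
     {..M} \<times> {xs. set xs \<subseteq> {..M} \<and> length xs = 2 * t})"

definition block_width :: "nat \<Rightarrow> nat \<Rightarrow> nat" where
  "block_width \<kappa> e = \<kappa> * ceil_log e + 1"

definition channels :: "nat \<Rightarrow> nat \<Rightarrow> nat \<Rightarrow> nat \<Rightarrow> (sieve \<times> nat) set" where
  "channels \<kappa> t e r = sieves \<kappa> t e r \<times> {..<block_width \<kappa> e}"

text \<open>All nodes know the arguments, so the choice is a common order in which sender and
  receiver index the bits of a message.\<close>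

definition channel_list :: "nat \<Rightarrow> nat \<Rightarrow> nat \<Rightarrow> nat \<Rightarrow> (sieve \<times> nat) list" where
  "channel_list \<kappa> t e r = (SOME cs. set cs = channels \<kappa> t e r \<and> distinct cs)"

text \<open>A message is encoded by its bits, a final 1 and zeros up to the block width, so that the zero
  block is free to stand for the absence of a message.\<close>

definition code_bit :: "message \<Rightarrow> nat \<Rightarrow> bool" where
  "code_bit m k \<longleftrightarrow> k = length m \<or> k < length m \<and> m ! k"

text \<open>Bits are merged by disjunction over the neighbours: in a reliable flood every neighbour sends
  the code of the payload or the zero block, and so does their disjunction. As the source never stops
  sending, only the last round of the history matters.\<close>

definition delivered :: "nat \<Rightarrow> nat \<Rightarrow> knowledge \<Rightarrow> history \<Rightarrow> sieve \<Rightarrow> nat \<Rightarrow> bool" where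
  "delivered \<kappa> t K h f k =
     (case input K of
        Some m \<Rightarrow> code_bit m k
      | None \<Rightarrow> h \<noteq> [] \<and> (\<exists>v. {own_id K, v} \<in> incident K \<and>
          passes \<kappa> (size_estimate K) f {own_id K, v} \<and>
          ((f, k), True) \<in> set (zip (channel_list \<kappa> t (size_estimate K) (length h - 1)) (last h v))))"

definition accepts :: "nat \<Rightarrow> nat \<Rightarrow> knowledge \<Rightarrow> history \<Rightarrow> message \<Rightarrow> bool" where
  "accepts \<kappa> t K h m \<longleftrightarrow>
     length m < block_width \<kappa> (size_estimate K) \<and>
     (\<forall>F\<subseteq>possible_edges \<kappa> (size_estimate K). card F \<le> t \<longrightarrow>
        (\<exists>f. (\<forall>E\<in>F. \<not> passes \<kappa> (size_estimate K) f E) \<and>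
             (\<forall>k<block_width \<kappa> (size_estimate K). delivered \<kappa> t K h f k = code_bit m k)))"

definition flood :: "nat \<Rightarrow> nat \<Rightarrow> protocol" where
  "flood \<kappa> t =
     \<lparr> send = (\<lambda>K h v. map (\<lambda>(f, k). delivered \<kappa> t K h f k)
         (channel_list \<kappa> t (size_estimate K) (length h))),
       decide = (\<lambda>K h. case input K of
         Some m \<Rightarrow> Some m
       | None \<Rightarrow> if \<exists>m. accepts \<kappa> t K h m then Some (SOME m. accepts \<kappa> t K h m) else None) \<rparr>"

section \<open>Number of channels, and indifference of the flood to surplus bits\<close>

lemma finite_sieves: "finite (sieves \<kappa> t e r)"
  and card_sieves: "card (sieves \<kappa> t e r) = Suc (modulus_bound \<kappa> t e r) ^ (2 * t + 1)"
  by (simp_all add: sieves_def Let_def finite_lists_length_eq card_cartesian_product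
      card_lists_length_eq)

lemma finite_channels: "finite (channels \<kappa> t e r)"
  and card_channels: "card (channels \<kappa> t e r) =
    Suc (modulus_bound \<kappa> t e r) ^ (2 * t + 1) * block_width \<kappa> e"
  by (simp_all add: channels_def finite_sieves card_cartesian_product card_sieves)

lemma card_channels_pos: "card (channels \<kappa> t e r) > 0"
  by (simp add: card_channels block_width_def)

lemma modulus_bound_mono: "r \<le> r' \<Longrightarrow> modulus_bound \<kappa> t e r \<le> modulus_bound \<kappa> t e r'"
  by (auto simp: modulus_bound_def intro!: mult_le_mono)

lemma sieves_mono: "r \<le> r' \<Longrightarrow> sieves \<kappa> t e r \<subseteq> sieves \<kappa> t e r'"
  using modulus_bound_mono[of r r' \<kappa> t e] unfolding sieves_def Let_def by fastforce

lemma set_channel_list: "set (channel_list \<kappa> t e r) = channels \<kappa> t e r"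
  and length_channel_list: "length (channel_list \<kappa> t e r) = card (channels \<kappa> t e r)"
proof -
  have "\<exists>cs. set cs = channels \<kappa> t e r \<and> distinct cs"
    by (rule finite_distinct_list[OF finite_channels])
  from someI_ex[OF this] show "set (channel_list \<kappa> t e r) = channels \<kappa> t e r"
      "length (channel_list \<kappa> t e r) = card (channels \<kappa> t e r)"
    unfolding channel_list_def by (auto simp flip: distinct_card)
qed

lemma zip_take_length: "zip xs (take (length xs) ys) = zip xs ys"
proof (induction xs arbitrary: ys)
  case (Cons x xs)
  then show ?case
    by (cases ys) auto
qed simp

lemma last_cut_off: "h \<noteq> [] \<Longrightarrow> last (cut_off b h) x = take (b (length h - 1)) (last h x)"
  by (simp add: cut_off_def last_map last_conv_nth)

lemma length_cut_off: "length (cut_off b h) = length h"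
  by (simp add: cut_off_def)

lemma cut_off_Nil_iff: "cut_off b h = [] \<longleftrightarrow> h = []"
  by (simp add: cut_off_def)

text \<open>Surplus bits are dropped by \<open>zip\<close> with the channel list of the round in
  which the message was sent.\<close>

lemma delivered_cut_off:
  "delivered \<kappa> t K (cut_off (\<lambda>r. card (channels \<kappa> t (size_estimate K) r)) h) = delivered \<kappa> t K h"
  unfolding fun_eq_iff delivered_def
  by (cases "h = []")
    (simp_all add: last_cut_off length_cut_off cut_off_Nil_iff zip_take_length
      split: option.split flip: length_channel_list)

lemma accepts_cut_off:
  "accepts \<kappa> t K (cut_off (\<lambda>r. card (channels \<kappa> t (size_estimate K) r)) h) = accepts \<kappa> t K h"
  unfolding fun_eq_iff accepts_def delivered_cut_off by simp

interpretation flood: bounded_protocol "flood \<kappa> t" "\<lambda>e r. card (channels \<kappa> t e r)" for \<kappa> t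
  by unfold_locales
    (simp_all add: flood_def card_channels_pos length_channel_list delivered_cut_off
      length_cut_off accepts_cut_off split: option.split)

text \<open>The final 1 is the last set bit of a code, so its position reveals the length.\<close>

lemma code_bit_inject:
  assumes "length m < w" "length m' < w" "\<forall>k<w. code_bit m k = code_bit m' k"
  shows "m = m'"
proof -
  have "length m \<le> length m'" "length m' \<le> length m"
    using assms by (auto simp: code_bit_def)
  then have eq: "length m = length m'"
    by simp
  show ?thesis
  proof (rule nth_equalityI[OF eq])
    fix k
    assume "k < length m"
    then show "m ! k = m' ! k"
      using assms(1) assms(3)[rule_format, of k] eq by (auto simp: code_bit_def)
  qed
qed

section \<open>Edge codes and sieves separating edge sets\<close>

lemma Min_Max_card_2:
  assumes "card (E :: nat set) = 2"
  shows "E = {Min E, Max E}"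
proof -
  obtain x y where "E = {x, y}"
    using assms by (auto simp: card_2_iff)
  then show ?thesis
    by (cases "x \<le> y") (auto simp: min_def max_def)
qed

lemma edge_code_less: "E \<in> possible_edges \<kappa> e \<Longrightarrow> edge_code \<kappa> e E < e ^ \<kappa> * e ^ \<kappa>"
  and edge_code_inj: "inj_on (edge_code \<kappa> e) (possible_edges \<kappa> e)"
proof -
  have bound: "Min E < e ^ \<kappa>" "Max E < e ^ \<kappa>" if "E \<in> possible_edges \<kappa> e" for E
  proof -
    have "E = {Min E, Max E}" "E \<subseteq> {..<e ^ \<kappa>}"
      using that Min_Max_card_2[of E] unfolding possible_edges_def by blast+
    then show "Min E < e ^ \<kappa>" "Max E < e ^ \<kappa>"
      by blast+
  qed
  show "edge_code \<kappa> e E < e ^ \<kappa> * e ^ \<kappa>" if "E \<in> possible_edges \<kappa> e"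
  proof -
    have "edge_code \<kappa> e E < e ^ \<kappa> * Suc (Max E)"
      using bound(1)[OF that] by (simp add: edge_code_def)
    also have "\<dots> \<le> e ^ \<kappa> * e ^ \<kappa>"
      using bound(2)[OF that] by (intro mult_left_mono) auto
    finally show ?thesis .
  qed
  show "inj_on (edge_code \<kappa> e) (possible_edges \<kappa> e)"
  proof (rule inj_onI)
    fix E E'
    assume E: "E \<in> possible_edges \<kappa> e" "E' \<in> possible_edges \<kappa> e"
      and eq: "edge_code \<kappa> e E = edge_code \<kappa> e E'"
    have "edge_code \<kappa> e E mod e ^ \<kappa> = Min E" "edge_code \<kappa> e E div e ^ \<kappa> = Max E"
        "edge_code \<kappa> e E' mod e ^ \<kappa> = Min E'" "edge_code \<kappa> e E' div e ^ \<kappa> = Max E'"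
      using bound[OF E(1)] bound[OF E(2)]
      by (simp_all only: edge_code_def mod_mult_self2 div_mult_self2 mod_less div_less not_less0
          not_gr0 add_0_right neq0_conv)
    then have "Min E = Min E'" "Max E = Max E'"
      using eq by simp_all
    moreover have "E = {Min E, Max E}" "E' = {Min E', Max E'}"
      using E by (auto simp only: possible_edges_def mem_Collect_eq intro!: Min_Max_card_2)
    ultimately show "E = E'"
      by metis
  qed
qed

lemma le_two_pow_ceil_log: "e \<ge> 1 \<Longrightarrow> e \<le> 2 ^ ceil_log e"
proof -
  assume "e \<ge> 1"
  then have "real e = 2 powr log 2 (real e)"
    by simp
  also have "\<dots> \<le> 2 powr real (ceil_log e)"
    unfolding ceil_log_def by (intro powr_mono) (auto simp: le_nat_iff real_nat_ceiling_ge)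
  also have "\<dots> = real (2 ^ ceil_log e)"
    by (simp add: powr_realpow)
  finally show ?thesis
    unfolding of_nat_le_iff .
qed

lemma separating_sieve:
  assumes "1 \<le> e" "finite A" "A \<subseteq> possible_edges \<kappa> e" "B \<subseteq> possible_edges \<kappa> e" "A \<inter> B = {}"
    and "card A \<le> L" "card B \<le> 2 * t" "finite B"
  obtains f where "f \<in> sieves \<kappa> t e L" "\<And>E. E \<in> A \<Longrightarrow> passes \<kappa> e f E"
    "\<And>E. E \<in> B \<Longrightarrow> \<not> passes \<kappa> e f E"
proof -
  let ?c = "edge_code \<kappa> e" and ?m = "2 * \<kappa> * t * L * ceil_log e + 1"
  \<comment> \<open>At most \<open>2 * t * L\<close> differences, each below
    \<open>e ^ (2 * \<kappa>)\<close>, give a product of at most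
    \<open>4 ^ (2 * \<kappa> * t * L * ceil_log e)\<close>; the \<open>+ 1\<close> in
    \<open>?m\<close> makes the bound strict.\<close>
  have "(e ^ \<kappa> * e ^ \<kappa>) ^ (card (?c ` A) * card (?c ` B)) \<le> (e ^ \<kappa> * e ^ \<kappa>) ^ (L * (2 * t))"
    using assms(1,2,6,7,8)
    by (intro power_increasing mult_le_mono) (auto intro: order.trans[OF card_image_le])
  also have "\<dots> \<le> ((2 ^ ceil_log e) ^ \<kappa> * (2 ^ ceil_log e) ^ \<kappa>) ^ (L * (2 * t))"
    using le_two_pow_ceil_log[OF assms(1)] by (intro power_mono mult_le_mono) auto
  also have "\<dots> = 2 ^ (2 * (2 * \<kappa> * t * L * ceil_log e))"
    by (simp flip: power_mult power_add add: algebra_simps)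
  also have "\<dots> = 4 ^ (2 * \<kappa> * t * L * ceil_log e)"
    by (simp add: power_mult)
  also have "\<dots> < 4 ^ ?m"
    by (rule power_strict_increasing) auto
  finally have bound: "(e ^ \<kappa> * e ^ \<kappa>) ^ (card (?c ` A) * card (?c ` B)) < 4 ^ ?m" .
  have disjoint: "?c ` A \<inter> ?c ` B = {}"
    using inj_on_image_Int[OF edge_code_inj assms(3,4)] assms(5) by simp
  have below: "?c ` A \<subseteq> {..<e ^ \<kappa> * e ^ \<kappa>}" "?c ` B \<subseteq> {..<e ^ \<kappa> * e ^ \<kappa>}"
    using assms(3,4) edge_code_less by auto
  obtain q where q: "0 < q" "q \<le> 2 * ?m + 1"
      "\<And>x y. x \<in> ?c ` A \<Longrightarrow> y \<in> ?c ` B \<Longrightarrow> x mod q \<noteq> y mod q"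
    using separating_modulus[OF finite_imageI finite_imageI disjoint below bound, OF assms(2,8)]
    by blast
  let ?R = "(\<lambda>E. ?c E mod q) ` B"
  obtain ys where ys: "set ys = ?R" "distinct ys"
    using finite_distinct_list[of ?R] assms(8) by auto
  have "length ys \<le> 2 * t"
    using ys card_image_le[OF assms(8), of "\<lambda>E. ?c E mod q"] assms(7)
    by (simp flip: distinct_card)
  txt \<open>No residue modulo \<open>q\<close> equals the padding \<open>q\<close>.\<close>
  define xs where "xs = ys @ replicate (2 * t - length ys) q"
  have xs: "length xs = 2 * t" "?R \<subseteq> set xs" "set xs \<subseteq> insert q ?R"
    using \<open>length ys \<le> 2 * t\<close> ys(1) by (auto simp: xs_def)
  have "?R \<subseteq> {..q}"
    using q(1) by (auto intro: less_imp_le)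
  then have "(q, xs) \<in> sieves \<kappa> t e L"
    using q(2) xs unfolding sieves_def Let_def modulus_bound_def by fastforce
  moreover have "passes \<kappa> e (q, xs) E" if "E \<in> A" for E
  proof -
    have "?c E mod q \<noteq> q"
      using mod_less_divisor[OF q(1), of "?c E"] by linarith
    then show ?thesis
      using q(3) xs(3) that unfolding passes_def by fastforce
  qed
  moreover have "\<not> passes \<kappa> e (q, xs) E" if "E \<in> B" for E
    using xs(2) that unfolding passes_def by auto
  ultimately show thesis
    by (rule that)
qed

section \<open>Executions of the flood under attack\<close>

lemma set_zip_map: "set (zip xs (map g xs)) = (\<lambda>x. (x, g x)) ` set xs"
  by (induction xs) auto

lemma finite_edges: "simple_graph V E \<Longrightarrow> finite E"
  by (rule finite_subset[of _ "Pow V"]) (auto simp: simple_graph_def)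

locale flood_execution =
  fixes \<kappa> t :: nat and N :: network and F :: "nat set set" and A :: adversary
  assumes ok: "network_ok \<kappa> N" and F: "F \<subseteq> links N" "card F \<le> t"
begin

abbreviation est :: nat where "est \<equiv> estimate N"

definition del :: "nat \<Rightarrow> nat \<Rightarrow> sieve \<Rightarrow> nat \<Rightarrow> bool" where
  "del r u = delivered \<kappa> t (initial_knowledge N u) (history_of (run (flood \<kappa> t) N F A r) u)"

lemma graph: "simple_graph (nodes N) (links N)" and source: "source N \<in> nodes N"
  using ok by (auto simp: network_ok_def)

lemma card_nodes_pos: "1 \<le> card (nodes N)"
  using graph by (auto simp: simple_graph_def Suc_le_eq card_gt_0_iff)

lemma est_bounds: "card (nodes N) \<le> est" "est \<le> card (nodes N) ^ \<kappa>"
  using ok by (auto simp: network_ok_def)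

lemma links_possible: "links N \<subseteq> possible_edges \<kappa> est"
proof
  fix E
  assume "E \<in> links N"
  then have "E \<subseteq> nodes N" "card E = 2"
    using graph by (auto simp: simple_graph_def)
  moreover have "v < est ^ \<kappa>" if "v \<in> nodes N" for v
  proof -
    have "v < card (nodes N) ^ \<kappa>"
      using ok that by (simp add: network_ok_def)
    also have "\<dots> \<le> est ^ \<kappa>"
      by (intro power_mono est_bounds) simp
    finally show ?thesis .
  qed
  ultimately show "E \<in> possible_edges \<kappa> est"
    by (auto simp: possible_edges_def)
qed

lemma finite_links: "finite (links N)"
  using finite_edges[OF graph] .

lemma length_payload: "length (payload N) < block_width \<kappa> est"
proof -
  have "real (length (payload N)) \<le> real \<kappa> * log 2 (real (card (nodes N)))"
    using ok by (simp add: network_ok_def)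
  also have "\<dots> \<le> real \<kappa> * log 2 (real est)"
    using card_nodes_pos est_bounds(1) by (intro mult_left_mono) auto
  also have "\<dots> \<le> real \<kappa> * real (ceil_log est)"
    unfolding ceil_log_def by (intro mult_left_mono real_nat_ceiling_ge) auto
  finally have "real (length (payload N)) \<le> real (\<kappa> * ceil_log est)"
    by simp
  then show ?thesis
    unfolding block_width_def of_nat_le_iff by simp
qed

lemma del_source: "del r (source N) f k = code_bit (payload N) k"
  by (simp add: del_def delivered_def initial_knowledge_def)

lemma del_0: "u \<noteq> source N \<Longrightarrow> \<not> del 0 u f k"
  by (simp add: del_def delivered_def initial_knowledge_def history_of_def)

text \<open>After \<open>r + 1\<close> rounds the last messages use the channels of round
  \<open>r\<close>. In a flood avoiding \<open>F\<close> they all come from honest links.\<close>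

lemma del_Suc:
  assumes "u \<noteq> source N" "\<forall>E\<in>F. \<not> passes \<kappa> est f E" "k < block_width \<kappa> est"
  shows "del (Suc r) u f k \<longleftrightarrow>
    f \<in> sieves \<kappa> t est r \<and> (\<exists>v. {u, v} \<in> links N \<and> passes \<kappa> est f {u, v} \<and> del r v f k)"
proof -
  have msg: "((f, k), True) \<in> set (zip (channel_list \<kappa> t est r)
        (next_round (flood \<kappa> t) N F A (run (flood \<kappa> t) N F A r) (v, u))) \<longleftrightarrow>
      f \<in> sieves \<kappa> t est r \<and> del r v f k"
    if "{u, v} \<in> links N" "passes \<kappa> est f {u, v}" for v
  proof -
    have "{v, u} \<notin> F" "{v, u} \<in> links N"
      using that assms(2) by (auto simp: insert_commute)
    then have "next_round (flood \<kappa> t) N F A (run (flood \<kappa> t) N F A r) (v, u) =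
        map (\<lambda>(f, k). del r v f k) (channel_list \<kappa> t est r)"
      by (simp add: next_round_def flood_def del_def length_history_of length_run
          size_estimate_initial)
    then show ?thesis
      using assms(3) by (auto simp: set_zip_map set_channel_list channels_def)
  qed
  have "last (history_of (run (flood \<kappa> t) N F A (Suc r)) u) =
      (\<lambda>v. next_round (flood \<kappa> t) N F A (run (flood \<kappa> t) N F A r) (v, u))"
    by (simp add: history_of_def)
  then show ?thesis
    using assms(1) msg
    by (auto simp: del_def[of "Suc r"] delivered_def initial_knowledge_def length_history_of
        length_run history_of_def simp del: run.simps(2) simp: run.simps(2)[of _ _ _ _ r])
qed

lemma del_honest:
  assumes "\<forall>E\<in>F. \<not> passes \<kappa> est f E"
  shows "(\<forall>k<block_width \<kappa> est. del r u f k = code_bit (payload N) k) \<or>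
    (\<forall>k<block_width \<kappa> est. \<not> del r u f k)"
proof (induction r arbitrary: u)
  case 0
  show ?case
    using del_source del_0 by (cases "u = source N") auto
next
  case (Suc r)
  show ?case
  proof (cases "u = source N")
    case True
    then show ?thesis
      by (simp add: del_source)
  next
    case False
    \<comment> \<open>Neither the links used nor the sieve test depend on \<open>k\<close>, so the
      disjunction of payload codes and zero blocks is again one of the two.\<close>
    then show ?thesis
      using del_Suc[OF False assms] Suc.IH by meson
  qed
qed

lemma accepts_sound:
  assumes "accepts \<kappa> t (initial_knowledge N u) (history_of (run (flood \<kappa> t) N F A r) u) m"
  shows "m = payload N"
proof -
  \<comment> \<open>Acceptance quantifies over all small sets, so it applies to the actual
    adversarial set.\<close>
  have "F \<subseteq> possible_edges \<kappa> est"
    using F(1) links_possible by simp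
  then obtain f where f: "\<forall>E\<in>F. \<not> passes \<kappa> est f E"
      "\<forall>k<block_width \<kappa> est. del r u f k = code_bit m k" and m: "length m < block_width \<kappa> est"
    using assms F(2) unfolding accepts_def del_def size_estimate_initial by blast
  \<comment> \<open>The end marker of \<open>m\<close> rules out the zero block.\<close>
  have "code_bit m (length m)"
    by (simp add: code_bit_def)
  then have "\<forall>k<block_width \<kappa> est. code_bit m k = code_bit (payload N) k"
    using del_honest[OF f(1), of r u] f(2) m by metis
  then show ?thesis
    using code_bit_inject m length_payload by blast
qed

text \<open>The flood \<open>f\<close> is surely available from round \<open>L\<close> on; then the
  code advances along the walk by one edge per round, as the source keeps sending.\<close>

lemma del_reaches:
  assumes "\<forall>E\<in>F. \<not> passes \<kappa> est f E" "f \<in> sieves \<kappa> t est L"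
    and "P \<subseteq> links N" "\<forall>E\<in>P. passes \<kappa> est f E"
    and "(source N, v) \<in> adj P ^^ j" "L + j \<le> r" "k < block_width \<kappa> est"
  shows "del r v f k = code_bit (payload N) k"
  using assms(5-7)
proof (induction j arbitrary: v r k)
  case 0
  then show ?case
    using del_source by auto
next
  case (Suc j)
  show ?case
  proof (cases "v = source N")
    case True
    then show ?thesis
      by (simp add: del_source)
  next
    case False
    obtain w where w: "(source N, w) \<in> adj P ^^ j" "(w, v) \<in> adj P"
      using Suc.prems(1) by (rule relpow_Suc_E)
    obtain r' where r': "r = Suc r'" "L + j \<le> r'"
      using Suc.prems(2) by (cases r) auto
    have edge: "{v, w} \<in> links N" "passes \<kappa> est f {v, w}"
      using w(2) assms(3,4) by (auto simp: adj_def insert_commute)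
    have active: "f \<in> sieves \<kappa> t est r'"
      using assms(2) sieves_mono[of L r' \<kappa> t est] r'(2) by auto
    \<comment> \<open>It is enough to see the end marker arrive: \<open>del_honest\<close> then
      supplies all other bits.\<close>
    have "code_bit (payload N) (length (payload N))"
      by (simp add: code_bit_def)
    then have "del r v f (length (payload N))"
      using del_Suc[OF False assms(1) length_payload] edge active
        Suc.IH[OF w(1) r'(2) length_payload] r'(1) by metis
    then show ?thesis
      using del_honest[OF assms(1), of r v] length_payload Suc.prems(3) by metis
  qed
qed

end

section \<open>Short detours and completeness of acceptance\<close>

lemma finite_gdists: "finite V \<Longrightarrow> finite {gdist E u v |u v. u \<in> V \<and> v \<in> V}"
  by (rule finite_subset[of _ "(\<lambda>(u, v). gdist E u v) ` (V \<times> V)"]) auto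

lemma gdist_le_diameter: "finite V \<Longrightarrow> u \<in> V \<Longrightarrow> v \<in> V \<Longrightarrow> gdist E u v \<le> diameter V E"
  unfolding diameter_def using finite_gdists by (intro Max_ge) auto

lemma rtrancl_adj_closed:
  assumes "simple_graph V E" "u \<in> V" "(u, v) \<in> (adj (E - X))\<^sup>*"
  shows "v \<in> V"
  using assms(3,2,1) by (induction rule: rtrancl_induct) (auto simp: adj_def simple_graph_def)

text \<open>Edge connectivity keeps the graph connected after deleting \<open>X\<close>, and
  \<open>4 * t + 1\<close> is \<open>2 * card X + 1\<close> at
  \<open>card X = 2 * t\<close>.\<close>

lemma short_path_avoiding:
  assumes "simple_graph V E" "edge_connected (2 * t + 1) V E" "s \<in> V" "v \<in> V"
    and X: "X \<subseteq> E" "card X \<le> 2 * t"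
  shows "\<exists>j\<le>(4 * t + 1) * (2 * diameter V E + 1). (s, v) \<in> adj (E - X) ^^ j"
proof -
  have fin: "finite V" "finite E"
    using assms(1) finite_edges by (auto simp: simple_graph_def)
  have conn: "(u, w) \<in> (adj (E - Y))\<^sup>*" if "u \<in> V" "w \<in> V" "Y \<subseteq> E" "card Y \<le> 2 * t" for u w Y
    using assms(2) that by (auto simp: edge_connected_def connected_graph_def)
  have "\<exists>k\<le>diameter V E. (u, s) \<in> adj E ^^ k" if "(s, u) \<in> (adj (E - X))\<^sup>*" for u
  proof -
    have u: "u \<in> V"
      using rtrancl_adj_closed[OF assms(1,3) that] .
    show ?thesis
      using conn[of u s "{}"] u assms(3) gdist_relpow gdist_le_diameter[OF fin(1) u assms(3)]
      by (intro exI[of _ "gdist E u s"]) auto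
  qed
  then have "gdist (E - X) s v < (2 * card X + 1) * (2 * diameter V E + 1)"
    using X(1) fin(2) assms(1) conn[OF assms(3,4) X]
    by (intro gdist_delete_edges) (auto simp: simple_graph_def intro: finite_subset)
  also have "\<dots> \<le> (4 * t + 1) * (2 * diameter V E + 1)"
    using X(2) by (intro mult_le_mono) auto
  finally show ?thesis
    using gdist_relpow[OF conn[OF assms(3,4) X]] by (meson less_imp_le)
qed

context flood_execution
begin

text \<open>\<open>L\<close> rounds make the separating sieve available, and up to \<open>L\<close>
  more carry the code along the path.\<close>

lemma accepts_complete:
  assumes "edge_connected (2 * t + 1) (nodes N) (links N)" "u \<in> nodes N"
    and L: "L = (4 * t + 1) * (2 * diameter (nodes N) (links N) + 1)"
  shows "accepts \<kappa> t (initial_knowledge N u) (history_of (run (flood \<kappa> t) N F A (2 * L)) u)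
    (payload N)"
  unfolding accepts_def size_estimate_initial
proof (intro conjI allI impI)
  fix F'
  assume F': "F' \<subseteq> possible_edges \<kappa> est" "card F' \<le> t"
  have fin: "finite F'" "finite F"
    using F'(1) finite_subset[OF F(1) finite_links]
    by (auto simp: possible_edges_def intro: finite_subset[of F' "Pow {..<est ^ \<kappa>}"])
  have card: "card (F \<union> F') \<le> 2 * t"
    using card_Un_le[of F F'] F(2) F'(2) by linarith
  \<comment> \<open>\<open>F'\<close> may contain pairs that are no links. The path avoids the links
    among them, while the sieve blocks all of \<open>F \<union> F'\<close>.\<close>
  let ?X = "F \<union> F' \<inter> links N"
  have "card ?X \<le> card (F \<union> F')"
    using fin by (intro card_mono) auto
  then obtain j where j: "j \<le> L" "(source N, u) \<in> adj (links N - ?X) ^^ j"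
    using short_path_avoiding[OF graph assms(1) source assms(2), of ?X] F(1) card L by auto
  obtain P where P: "finite P" "card P \<le> j" "P \<subseteq> links N - ?X" "(source N, u) \<in> adj P ^^ j"
    using relpow_edge_set[OF j(2)] .
  have "P \<inter> (F \<union> F') = {}" "P \<subseteq> possible_edges \<kappa> est" "F \<union> F' \<subseteq> possible_edges \<kappa> est"
    using P(3) F(1) F'(1) links_possible by auto
  then obtain f where f: "f \<in> sieves \<kappa> t est L" "\<And>E. E \<in> P \<Longrightarrow> passes \<kappa> est f E"
      "\<And>E. E \<in> F \<union> F' \<Longrightarrow> \<not> passes \<kappa> est f E"
    using separating_sieve[of est P \<kappa> "F \<union> F'" L t] P(1,2) j(1) card fin est_bounds(1)
      card_nodes_pos by (metis finite_UnI order.trans)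
  have "del (2 * L) u f k = code_bit (payload N) k" if "k < block_width \<kappa> est" for k
    using f P(3,4) j(1) that by (intro del_reaches) auto
  then show "\<exists>f. (\<forall>E\<in>F'. \<not> passes \<kappa> est f E) \<and>
      (\<forall>k<block_width \<kappa> est. delivered \<kappa> t (initial_knowledge N u)
        (history_of (run (flood \<kappa> t) N F A (2 * L)) u) f k = code_bit (payload N) k)"
    using f(3) by (intro exI[of _ f]) (auto simp: del_def)
qed (rule length_payload)

lemma outputs_by_flood:
  assumes "edge_connected (2 * t + 1) (nodes N) (links N)" "u \<in> nodes N"
    and L: "L = (4 * t + 1) * (2 * diameter (nodes N) (links N) + 1)"
  shows "outputs_by (flood \<kappa> t) N F A u (2 * L) (payload N)"
proof -
  let ?d = "decision_at (flood \<kappa> t) N F A u"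
  \<comment> \<open>A wrong decision never occurs at any time, so the first decision is correct
    whenever it falls.\<close>
  have only: "?d r = None \<or> ?d r = Some (payload N)" for r
  proof (cases "u = source N")
    case False
    let ?acc = "accepts \<kappa> t (initial_knowledge N u) (history_of (run (flood \<kappa> t) N F A r) u)"
    have "?d r = (if \<exists>m. ?acc m then Some (SOME m. ?acc m) else None)"
      using False by (simp add: decision_at_def flood_def initial_knowledge_def)
    moreover have "(SOME m. ?acc m) = payload N" if "\<exists>m. ?acc m"
      using someI_ex[OF that] by (rule accepts_sound)
    ultimately show ?thesis
      by simp
  qed (simp add: decision_at_def flood_def initial_knowledge_def)
  have some: "?d (2 * L) \<noteq> None"
    using accepts_complete[OF assms]
    by (auto simp: decision_at_def flood_def split: option.split)
  define i where "i = (LEAST r. ?d r \<noteq> None)"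
  have "?d i = Some (payload N)"
    using LeastI[of "\<lambda>r. ?d r \<noteq> None", OF some] only[of i] unfolding i_def by metis
  moreover have "i \<le> 2 * L"
    using Least_le[of "\<lambda>r. ?d r \<noteq> None", OF some] unfolding i_def .
  moreover have "?d j = None" if "j < i" for j
    using not_less_Least[OF that[unfolded i_def]] by blast
  ultimately show ?thesis
    unfolding outputs_by_def by (intro exI[of _ i]) simp
qed

end

lemma solves_broadcast_flood:
  assumes "network_ok \<kappa> N" "edge_connected (2 * t + 1) (nodes N) (links N)"
  shows "solves_broadcast \<infinity> t (flood \<kappa> t) N
    (2 * ((4 * t + 1) * (2 * diameter (nodes N) (links N) + 1)))"
  unfolding solves_broadcast_def
proof (intro allI impI ballI)
  fix F A u
  assume "F \<subseteq> links N" "card F \<le> t" and u: "u \<in> nodes N"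
  then interpret flood_execution \<kappa> t N F A
    using assms(1) by unfold_locales
  show "outputs_by (flood \<kappa> t) N F A u
      (2 * ((4 * t + 1) * (2 * diameter (nodes N) (links N) + 1))) (payload N)"
    by (rule outputs_by_flood[OF assms(2) u refl])
qed

text \<open>Deleting all edges at a vertex isolates it, so its degree is at least
  \<open>2 * t + 1 \<ge> 3\<close>. The result gives log n \<ge> 2.\<close>

lemma four_le_card:
  assumes "simple_graph V E" "edge_connected (2 * t + 1) V E" "t \<ge> 1"
  shows "4 \<le> card V"
proof (rule ccontr)
  assume small: "\<not> 4 \<le> card V"
  have fin: "finite V"
    using assms(1) by (simp add: simple_graph_def)
  obtain s v where sv: "s \<in> V" "v \<in> V" "s \<noteq> v"
    using assms(2) fin by (auto simp: edge_connected_def card_le_Suc_iff numeral_2_eq_2)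
  let ?X = "{e \<in> E. s \<in> e}"
  have "?X \<subseteq> (\<lambda>w. {s, w}) ` (V - {s})"
  proof
    fix e
    assume e: "e \<in> ?X"
    then have "e \<subseteq> V" "card e = 2"
      using assms(1) by (auto simp: simple_graph_def)
    then show "e \<in> (\<lambda>w. {s, w}) ` (V - {s})"
      using e by (auto simp: card_2_iff insert_commute)
  qed
  then have "card ?X \<le> card (V - {s})"
    using fin by (meson finite_Diff finite_imageI card_mono card_image_le order.trans)
  also have "\<dots> < 2 * t + 1"
    using small assms(3) sv(1) fin by simp
  finally have "(s, v) \<in> (adj (E - ?X))\<^sup>*"
    using assms(2) sv by (auto simp: edge_connected_def connected_graph_def)
  then show False
    using sv(3) by (cases rule: converse_rtranclE) (auto simp: adj_def)
qed

lemma diameter_pos: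
  assumes "simple_graph V E" "edge_connected k V E" "k > 0"
  shows "1 \<le> diameter V E"
proof -
  have fin: "finite V"
    using assms(1) by (simp add: simple_graph_def)
  obtain s v where sv: "s \<in> V" "v \<in> V" "s \<noteq> v"
    using assms(2) fin by (auto simp: edge_connected_def card_le_Suc_iff numeral_2_eq_2)
  have "(s, v) \<in> (adj (E - {}))\<^sup>*"
    using assms(2,3) sv unfolding edge_connected_def connected_graph_def
    by (metis card.empty empty_subsetI)
  then have "(s, v) \<in> adj E ^^ gdist E s v"
    by (auto dest: gdist_relpow)
  then have "gdist E s v \<noteq> 0"
    using sv(3) by (metis pair_in_Id_conv relpow.simps(1))
  then show ?thesis
    using gdist_le_diameter[OF fin sv(1,2), of E] by linarith
qed

section \<open>Round complexity\<close>

lemma offset_channels_le: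
  "offset (\<lambda>r. card (channels \<kappa> t e r)) R \<le>
    R * (Suc (modulus_bound \<kappa> t e R) ^ (2 * t + 1) * block_width \<kappa> e)"
proof -
  have "offset (\<lambda>r. card (channels \<kappa> t e r)) R \<le>
      (\<Sum>i<R. Suc (modulus_bound \<kappa> t e R) ^ (2 * t + 1) * block_width \<kappa> e)"
    unfolding offset_def card_channels
    by (intro sum_mono mult_right_mono power_mono) (auto intro: modulus_bound_mono)
  then show ?thesis
    by simp
qed

text \<open>Since the bound \<open>(t D log n) ^ (c t)\<close> has no leading constant, all constants are absorbed into
  the exponent, using \<open>t D log n \<ge> 2\<close>.\<close>

lemma const_le_power:
  assumes "2 \<le> (x :: real)" "y \<le> real c * x ^ k" "c \<le> 2 ^ j"
  shows "y \<le> x ^ (k + j)"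
proof -
  have "y \<le> real c * x ^ k"
    by fact
  also have "\<dots> \<le> 2 ^ j * x ^ k"
    using assms(1) of_nat_mono[OF assms(3), where 'a = real] by (intro mult_right_mono) auto
  also have "\<dots> \<le> x ^ j * x ^ k"
    using assms(1) by (intro mult_right_mono power_mono) auto
  finally show ?thesis
    by (simp add: power_add mult.commute)
qed

lemma round_bound:
  assumes "t \<ge> 1" "D \<ge> 1" "4 \<le> n" "1 \<le> \<kappa>" "1 \<le> e" "e \<le> n ^ \<kappa>"
    and R: "R = 2 * ((4 * t + 1) * (2 * D + 1))"
    and x: "x = real t * real D * log 2 (real n)"
  shows "real R \<le> 30 * x"
    and "real (offset (\<lambda>r. card (channels \<kappa> t e r)) R) \<le> x ^ ((42 + 8 * \<kappa>) * t)"
proof -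
  define l where "l = log 2 (real n)"
  have l: "2 \<le> l"
    using assms(3) by (simp add: l_def le_log_iff)
  have tD: "1 \<le> real t" "1 \<le> real D" "1 \<le> real \<kappa>"
    using assms by auto
  have x_eq: "x = real t * real D * l"
    by (simp add: x l_def)
  have one_le_tD: "1 \<le> real t * real D"
    using mult_mono[OF tD(1,2)] tD by simp
  have tDx: "real t * real D \<le> x"
    unfolding x_eq using mult_left_mono[of 1 l "real t * real D"] l one_le_tD by simp
  have lx: "l \<le> x"
    unfolding x_eq using mult_right_mono[OF one_le_tD, of l] l by simp
  then have x2: "2 \<le> x"
    using l by simp
  have t_le: "real t \<le> x"
    using order.trans[OF _ tDx, of "real t"] mult_left_mono[OF tD(2), of "real t"] by simp
  \<comment> \<open>\<open>4 * t + 1 \<le> 5 * t\<close> and \<open>2 * D + 1 \<le> 3 * D\<close>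
    produce the constant 30.\<close>
  have "R \<le> 2 * ((5 * t) * (3 * D))"
    unfolding R using assms(1,2) by (intro mult_le_mono) auto
  then have R_tD: "real R \<le> 30 * (real t * real D)"
    using of_nat_mono[of R "2 * ((5 * t) * (3 * D))", where 'a = real] by simp
  then show Rx: "real R \<le> 30 * x"
    using tDx by linarith
  have "log 2 (real e) \<le> log 2 (real (n ^ \<kappa>))"
    using assms(3,5,6) of_nat_mono[OF assms(6), where 'a = real]
    by (intro log_mono) auto
  also have "\<dots> = real \<kappa> * l"
    using assms(3) by (simp add: l_def log_nat_power)
  finally have log_e: "log 2 (real e) \<le> real \<kappa> * l" .
  have "0 \<le> log 2 (real e)"
    using assms(5) by simp
  then have "real (ceil_log e) \<le> log 2 (real e) + 1"
    unfolding ceil_log_def by linarith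
  also have "\<dots> \<le> real \<kappa> * l + real \<kappa> * l"
    using log_e l tD mult_mono[of 1 "real \<kappa>" 1 l] by linarith
  also have "\<dots> \<le> 2 * real \<kappa> * x"
    using lx tD by simp
  finally have ceil: "real (ceil_log e) \<le> 2 * real \<kappa> * x" .
  \<comment> \<open>Factors \<kappa> are absorbed into the exponent like numerical
    constants.\<close>
  have \<kappa>_pow: "\<kappa> * \<kappa> \<le> 2 ^ (2 * \<kappa>)"
    using mult_le_mono[of \<kappa> "2 ^ \<kappa>" \<kappa> "2 ^ \<kappa>"] less_exp[of \<kappa>]
    by (simp add: mult_2 power_add less_imp_le)
  have one_le: "1 \<le> real \<kappa> * real \<kappa>" "1 \<le> x ^ 3" "1 \<le> x"
    using tD mult_mono[of 1 "real \<kappa>" 1 "real \<kappa>"] x2 by auto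
  \<comment> \<open>The constant is \<open>244 = 4 * 30 * 2 + 4 \<le> 2 ^ 8\<close>; with
    \<open>\<kappa> * \<kappa> \<le> 2 ^ (2 * \<kappa>)\<close> it costs
    \<open>8 + 2 * \<kappa>\<close> in the exponent.\<close>
  have "real (Suc (modulus_bound \<kappa> t e R)) =
      4 * real \<kappa> * real t * real R * real (ceil_log e) + 4"
    by (simp add: modulus_bound_def algebra_simps)
  also have "\<dots> \<le> 4 * real \<kappa> * x * (30 * x) * (2 * real \<kappa> * x) + 4 * ((real \<kappa> * real \<kappa>) * x ^ 3)"
    using t_le Rx ceil x2 tD one_le mult_mono[OF one_le(1,2)]
    by (intro add_mono mult_mono) auto
  also have "\<dots> = real (244 * (\<kappa> * \<kappa>)) * x ^ 3"
    by (simp add: algebra_simps power3_eq_cube)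
  finally have "real (Suc (modulus_bound \<kappa> t e R)) \<le> x ^ (3 + (8 + 2 * \<kappa>))"
    by (rule const_le_power[OF x2]) (use \<kappa>_pow in \<open>simp add: power_add\<close>)
  then have Q: "real (Suc (modulus_bound \<kappa> t e R)) \<le> x ^ (11 + 2 * \<kappa>)"
    by (simp add: add.assoc[symmetric])
  have "real (block_width \<kappa> e) = real \<kappa> * real (ceil_log e) + 1"
    by (simp add: block_width_def)
  also have "\<dots> \<le> real \<kappa> * (2 * real \<kappa> * x) + (real \<kappa> * real \<kappa>) * x"
    using ceil tD one_le mult_mono[OF one_le(1,3)] by (intro add_mono mult_left_mono) auto
  also have "\<dots> = real (3 * (\<kappa> * \<kappa>)) * x ^ 1"
    by (simp add: algebra_simps)
  finally have W: "real (block_width \<kappa> e) \<le> x ^ (1 + (2 + 2 * \<kappa>))"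
    by (rule const_le_power[OF x2]) (use \<kappa>_pow in \<open>simp add: power_add\<close>)
  have R': "real R \<le> x ^ (1 + 5)"
    by (rule const_le_power[OF x2, of _ 30]) (use Rx in simp_all)
  have "real (offset (\<lambda>r. card (channels \<kappa> t e r)) R) \<le>
      real R * (real (Suc (modulus_bound \<kappa> t e R)) ^ (2 * t + 1) * real (block_width \<kappa> e))"
    using of_nat_mono[OF offset_channels_le[of \<kappa> t e R], where 'a = real]
    by (simp del: of_nat_Suc power_Suc add: of_nat_mult of_nat_power)
  also have "\<dots> \<le> x ^ (1 + 5) * ((x ^ (11 + 2 * \<kappa>)) ^ (2 * t + 1) * x ^ (1 + (2 + 2 * \<kappa>)))"
    using R' Q W x2 by (intro mult_mono power_mono) auto
  also have "\<dots> = x ^ (6 + ((11 + 2 * \<kappa>) * (2 * t + 1) + (3 + 2 * \<kappa>)))"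
    by (simp only: power_mult[symmetric] power_add[symmetric]) (rule arg_cong[of _ _ "(^) x"], simp)
  also have "\<dots> \<le> x ^ ((42 + 8 * \<kappa>) * t)"
  \<comment> \<open>The exponent is at most
    \<open>(33 + 6 * \<kappa>) * t + (9 + 2 * \<kappa>) * t\<close>.\<close>
  proof (rule power_increasing)
    have "(11 + 2 * \<kappa>) * (2 * t + 1) \<le> (11 + 2 * \<kappa>) * (3 * t)"
      using assms(1) by (intro mult_le_mono) auto
    moreover have "9 + 2 * \<kappa> \<le> (9 + 2 * \<kappa>) * t"
      using assms(1) by simp
    ultimately show "6 + ((11 + 2 * \<kappa>) * (2 * t + 1) + (3 + 2 * \<kappa>)) \<le> (42 + 8 * \<kappa>) * t"
      by (simp add: algebra_simps)
  qed (use x2 in simp)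
  finally show "real (offset (\<lambda>r. card (channels \<kappa> t e r)) R) \<le> x ^ ((42 + 8 * \<kappa>) * t)" .
qed

theorem theorem2:
  fixes \<kappa> :: nat
  shows "\<exists>\<beta> c C :: nat. \<forall>t\<ge>1. \<exists>P Q.
    congest_protocol \<kappa> \<beta> P \<and>
    local_implementation \<kappa> \<beta> Q P \<and>
    (\<forall>N. network_ok \<kappa> N \<and> edge_connected (2 * t + 1) (nodes N) (links N) \<longrightarrow>
       (\<exists>R. real R \<le> (real t * real (diameter (nodes N) (links N)) *
                         log 2 (real (card (nodes N)))) ^ (c * t) \<and>
            solves_broadcast (congest_capacity \<beta> N) t P N R) \<and>
       (\<exists>R. real R \<le> real C * (real t * real (diameter (nodes N) (links N)) *
                         log 2 (real (card (nodes N)))) \<and>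
            solves_broadcast \<infinity> t Q N R))"
\<comment> \<open>The capacity factor is 1 because every CONGEST message is a single bit; the other
  two witnesses come from \<open>round_bound\<close>.\<close>
proof (rule exI[of _ 1], rule exI[of _ "42 + 8 * \<kappa>"], rule exI[of _ 30], intro allI impI)
  fix t :: nat
  assume t: "t \<ge> 1"
  let ?Q = "flood \<kappa> t" and ?b = "\<lambda>e r. card (channels \<kappa> t e r)"
  let ?P = "serialise ?b ?Q"
  have main: "(\<exists>R. real R \<le> (real t * real (diameter (nodes N) (links N)) *
            log 2 (real (card (nodes N)))) ^ ((42 + 8 * \<kappa>) * t) \<and>
          solves_broadcast (congest_capacity 1 N) t ?P N R) \<and>
        (\<exists>R. real R \<le> real 30 * (real t * real (diameter (nodes N) (links N)) *
            log 2 (real (card (nodes N)))) \<and> solves_broadcast \<infinity> t ?Q N R)"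
    if N: "network_ok \<kappa> N" "edge_connected (2 * t + 1) (nodes N) (links N)" for N
  proof -
    have graph: "simple_graph (nodes N) (links N)"
      using N(1) by (simp add: network_ok_def)
    have card: "4 \<le> card (nodes N)"
      by (rule four_le_card[OF graph N(2) t])
    have D: "1 \<le> diameter (nodes N) (links N)"
      by (rule diameter_pos[OF graph N(2)]) simp
    have e: "card (nodes N) \<le> estimate N" "estimate N \<le> card (nodes N) ^ \<kappa>"
      using N(1) by (auto simp: network_ok_def)
    \<comment> \<open>For \<kappa> = 0 the estimate would force \<open>n \<le> 1\<close>.\<close>
    then have \<kappa>: "1 \<le> \<kappa>"
      using card by (cases \<kappa>) auto
    have e1: "1 \<le> estimate N"
      using card e(1) by linarith
    note bounds = round_bound[OF t D card \<kappa> e1 e(2) refl refl]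
    note Q = solves_broadcast_flood[OF N]
    show ?thesis
    proof (intro conjI exI)
      show "real (offset (?b (estimate N)) (2 * ((4 * t + 1) * (2 * diameter (nodes N) (links N) + 1))))
          \<le> (real t * real (diameter (nodes N) (links N)) *
            log 2 (real (card (nodes N)))) ^ ((42 + 8 * \<kappa>) * t)"
        by (rule bounds(2))
      show "real (2 * ((4 * t + 1) * (2 * diameter (nodes N) (links N) + 1))) \<le>
          real 30 * (real t * real (diameter (nodes N) (links N)) * log 2 (real (card (nodes N))))"
        using bounds(1) unfolding of_nat_numeral .
    qed (rule flood.solves_broadcast_serialise[OF Q] Q)+
  qed
  show "\<exists>P Q. congest_protocol \<kappa> 1 P \<and> local_implementation \<kappa> 1 Q P \<and>
    (\<forall>N. network_ok \<kappa> N \<and> edge_connected (2 * t + 1) (nodes N) (links N) \<longrightarrow>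
       (\<exists>R. real R \<le> (real t * real (diameter (nodes N) (links N)) *
                         log 2 (real (card (nodes N)))) ^ ((42 + 8 * \<kappa>) * t) \<and>
            solves_broadcast (congest_capacity 1 N) t P N R) \<and>
       (\<exists>R. real R \<le> real 30 * (real t * real (diameter (nodes N) (links N)) *
                         log 2 (real (card (nodes N)))) \<and>
            solves_broadcast \<infinity> t Q N R))"
    using flood.congest_protocol_serialise flood.local_implementation_serialise main by blast
qed

end
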